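(* For $q$ with $0<|q|<1$ and $\zeta$ with $|q|<|\zeta|<1$, define $$\bar P_\omega(\zeta;q):=\frac{(q;q)_\infty}{(\zeta;q)_\infty(\zeta^{-1}q;q)_\infty(-q;q^2)_\infty}\sum_{n\ge1}\frac{(\zeta;q)_n(\zeta^{-1}q;q)_n(-q;q^2)_n}{(q;q)_{2n}}q^n.$$ Then $$\bar P_\omega(\zeta;q)=\frac{1}{(\zeta;q)_\infty(\zeta^{-1}q;q)_\infty(q;q)_\infty}\sum_{j\ge1}\sum_{n\ge0}\frac{(-1)^{j+1}i^n(1-\zeta^j)\big(1-(\zeta^{-1}q)^j\big)q^{\frac{j(j+1)}{2}+n(j+\frac12)}}{1+iq^{j+n+\frac12}}.$$
   Context: $(a;q)_n=\prod_{j=0}^{n-1}(1-aq^j)$ for $n\in\mathbb N_0\cup\{\infty\}$. Here $q=e^{2\pi i\tau}$ with $\tau\in\mathbb H$ and $q^{r}:=e^{2\pi i r\tau}$ for rational $r$. Note $\bar P_\omega(1;q)$ (taken as a limit $\zeta\to1$) equals the overpartition generating function $\bar P_\omega(q)=\sum_{n\ge1}\frac{(-q^{n+1};q)_n(-q^{2n+2};q^2)_\infty}{(1-q^n)(q^{n+1};q)_n(q^{2n+2};q^2)_\infty}q^n$. *)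

theory Defs
  imports "HOL-Analysis.Analysis"
begin

definition qpoch :: "complex \<Rightarrow> complex \<Rightarrow> nat \<Rightarrow> complex" where
  "qpoch a q n = (\<Prod>j<n. 1 - a * q ^ j)"

definition qpoch_inf :: "complex \<Rightarrow> complex \<Rightarrow> complex" where
  "qpoch_inf a q = (\<Prod>j. 1 - a * q ^ j)"

definition Pbar_omega :: "complex \<Rightarrow> complex \<Rightarrow> complex" where
  "Pbar_omega \<zeta> q =
     qpoch_inf q q / (qpoch_inf \<zeta> q * qpoch_inf (q / \<zeta>) q * qpoch_inf (- q) (q ^ 2)) *
     (\<Sum>m. (let n = Suc m in
        qpoch \<zeta> q n * qpoch (q / \<zeta>) q n * qpoch (- q) (q ^ 2) n / qpoch q q (2 * n) * q ^ n))"

end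

theory Submission
  imports Defs
begin

text \<open>
  By the finite Jacobi triple product, \<open>(\<zeta>;q)\<^sub>n (q/\<zeta>;q)\<^sub>n / (q;q)\<^sub>2\<^sub>n\<close> is a combination of
  \<open>(1 - \<zeta>\<^sup>j) (1 - (q/\<zeta>)\<^sup>j) / ((q;q)\<^sub>n\<^sub>-\<^sub>j (q;q)\<^sub>n\<^sub>+\<^sub>j)\<close> for \<open>1 \<le> j \<le> n\<close>. After interchanging the
  sums over \<open>n\<close> and \<open>j\<close>, the sum over \<open>n\<close> is a basic hypergeometric series
  \<open>\<^sub>2\<phi>\<^sub>1(a, b; a b; q, q)\<close> with \<open>a = - \<i> q\<^bsup>j+1/2\<^esup>\<close> and \<open>b = \<i> q\<^bsup>j+1/2\<^esup>\<close>, because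
  \<open>(-q;q\<^sup>2)\<^sub>n = (\<i> q\<^bsup>1/2\<^esup>;q)\<^sub>n (-\<i> q\<^bsup>1/2\<^esup>;q)\<^sub>n\<close>. Heine's transformation turns it into
  \<open>\<Sum>\<^sub>n b\<^sup>n / (1 - a q\<^sup>n)\<close>, the inner sum on the right-hand side.
\<close>

section \<open>q-Pochhammer symbols: splitting, convergence, non-vanishing and uniform
  bounds\<close>

lemma qpoch_0 [simp]: "qpoch a q 0 = 1"
  by (simp add: qpoch_def)

lemma qpoch_Suc: "qpoch a q (Suc n) = qpoch a q n * (1 - a * q ^ n)"
  by (simp add: qpoch_def)

lemma qpoch_add: "qpoch a q (m + n) = qpoch a q m * qpoch (a * q ^ m) q n"
  by (induction n) (simp_all add: qpoch_Suc power_add mult.assoc)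

lemma one_minus_mult_power_nonzero:
  fixes a q :: complex
  assumes "norm q < 1" "norm a < 1"
  shows "1 - a * q ^ n \<noteq> 0"
proof
  assume "1 - a * q ^ n = 0"
  then have "norm (a * q ^ n) = 1" by simp
  moreover have "norm (a * q ^ n) \<le> norm a * 1"
    unfolding norm_mult norm_power using assms by (intro mult_left_mono power_le_one) auto
  ultimately show False using assms by simp
qed

lemma qpoch_nonzero:
  assumes "norm q < 1" "norm a < 1"
  shows "qpoch a q n \<noteq> 0"
  using one_minus_mult_power_nonzero[OF assms] by (simp add: qpoch_def)

lemma convergent_prod_qpoch:
  fixes a q :: complex
  assumes "norm q < 1"
  shows "convergent_prod (\<lambda>j. 1 - a * q ^ j)"
proof -
  have "summable (\<lambda>j. norm a * norm q ^ j)"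
    using assms by (intro summable_mult summable_geometric) simp
  then have "abs_convergent_prod (\<lambda>j. 1 - a * q ^ j)"
    by (simp add: abs_convergent_prod_conv_summable norm_mult norm_power)
  then show ?thesis
    by (rule abs_convergent_prod_imp_convergent_prod)
qed

lemma qpoch_LIMSEQ:
  assumes "norm q < 1"
  shows "qpoch a q \<longlonglongrightarrow> qpoch_inf a q"
proof -
  have "(\<lambda>n. qpoch a q (Suc n)) \<longlonglongrightarrow> qpoch_inf a q"
    using convergent_prod_LIMSEQ[OF convergent_prod_qpoch[OF assms, of a]]
    by (simp add: qpoch_def qpoch_inf_def lessThan_Suc_atMost)
  then show ?thesis
    by (simp only: filterlim_sequentially_Suc)
qed

lemma qpoch_inf_nonzero:
  assumes "norm q < 1" "norm a < 1"
  shows "qpoch_inf a q \<noteq> 0"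
  unfolding qpoch_inf_def
  by (rule prodinf_nonzero[OF convergent_prod_qpoch])
     (use assms one_minus_mult_power_nonzero in auto)

lemma qpoch_inf_split:
  assumes "norm q < 1"
  shows "qpoch_inf a q = qpoch a q m * qpoch_inf (a * q ^ m) q"
proof (rule LIMSEQ_unique)
  show "(\<lambda>n. qpoch a q (m + n)) \<longlonglongrightarrow> qpoch_inf a q"
    using LIMSEQ_ignore_initial_segment[OF qpoch_LIMSEQ[OF assms, of a], of m]
    by (simp add: add.commute)
  show "(\<lambda>n. qpoch a q (m + n)) \<longlonglongrightarrow> qpoch a q m * qpoch_inf (a * q ^ m) q"
    unfolding qpoch_add by (intro tendsto_intros qpoch_LIMSEQ assms)
qed

lemma qpoch_bounded:
  assumes "norm q < 1"
  obtains M where "M > 0" "\<And>n. norm (qpoch a q n) \<le> M"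
  using Bseq_def[of "qpoch a q"] convergent_imp_Bseq[OF convergentI[OF qpoch_LIMSEQ[OF assms]]]
  by blast

lemma inverse_qpoch_bounded:
  assumes "norm q < 1" "norm a < 1"
  obtains M where "M > 0" "\<And>n. norm (inverse (qpoch a q n)) \<le> M"
  using Bseq_def[of "\<lambda>n. inverse (qpoch a q n)"]
    convergent_imp_Bseq[OF convergentI[OF tendsto_inverse[OF qpoch_LIMSEQ qpoch_inf_nonzero]]] assms
  by metis

text \<open>These quotients are the coefficients of the q-binomial series; a uniform bound lets
  geometric series dominate every sum built from them.\<close>

lemma qpoch_ratio_bounded:
  assumes "norm q < 1"
  obtains M where "M > 0" "\<And>n. norm (qpoch a q n / qpoch q q n) \<le> M"
proof -
  obtain A where A: "A > 0" "\<And>n. norm (qpoch a q n) \<le> A"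
    using qpoch_bounded[OF assms] by blast
  obtain B where B: "B > 0" "\<And>n. norm (inverse (qpoch q q n)) \<le> B"
    using inverse_qpoch_bounded[OF assms assms] by blast
  show ?thesis
  proof (rule that)
    show "A * B > 0" using A B by simp
    show "norm (qpoch a q n / qpoch q q n) \<le> A * B" for n
      unfolding divide_inverse norm_mult using A B by (intro mult_mono) (auto intro: less_imp_le)
  qed
qed

text \<open>Factorwise this is \<open>1 + x ^ 2 = (1 - \<i> * x) * (1 + \<i> * x)\<close> with
  \<open>x = h * q ^ j\<close>. For \<open>h ^ 2 = q\<close> it rewrites the
  base-\<open>q ^ 2\<close> symbol of \<open>- q\<close> in base \<open>q\<close>, as Heine's
  transformation requires.\<close>

lemma qpoch_neg_square: "qpoch (- (h ^ 2)) (q ^ 2) n = qpoch (\<i> * h) q n * qpoch (- \<i> * h) q n"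
proof -
  have "1 - - (h ^ 2) * (q ^ 2) ^ j = (1 - \<i> * h * q ^ j) * (1 - - \<i> * h * q ^ j)" for j
    by (simp add: algebra_simps power2_eq_square power_mult_distrib flip: power_mult)
  then show ?thesis
    unfolding qpoch_def by (simp only: prod.distrib)
qed

lemma qpoch_inf_neg_square:
  assumes "norm q < 1"
  shows "qpoch_inf (- (h ^ 2)) (q ^ 2) = qpoch_inf (\<i> * h) q * qpoch_inf (- \<i> * h) q"
proof (rule LIMSEQ_unique)
  have "norm (q ^ 2) < 1"
    using assms by (simp add: norm_power power_less_one_iff)
  then show "qpoch (- (h ^ 2)) (q ^ 2) \<longlonglongrightarrow> qpoch_inf (- (h ^ 2)) (q ^ 2)"
    by (rule qpoch_LIMSEQ)
  show "qpoch (- (h ^ 2)) (q ^ 2) \<longlonglongrightarrow> qpoch_inf (\<i> * h) q * qpoch_inf (- \<i> * h) q"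
    unfolding qpoch_neg_square by (intro tendsto_intros qpoch_LIMSEQ assms)
qed

section \<open>Interchanging iterated series\<close>

text \<open>The bound makes \<open>f\<close> absolutely summable over all pairs, so Fubini for
  unordered sums applies; the result is stated with \<open>sums\<close> so that convergence of both
  outer series is included.\<close>

lemma sums_swap_geometric_bound:
  fixes f :: "nat \<Rightarrow> nat \<Rightarrow> complex"
  assumes bound: "\<And>m n. norm (f m n) \<le> C * x ^ m * y ^ n"
    and "0 \<le> x" "x < 1" "0 \<le> y" "y < 1"
  obtains S where "(\<lambda>m. \<Sum>n. f m n) sums S" "(\<lambda>n. \<Sum>m. f m n) sums S"
proof -
  have gx: "(\<lambda>m. x ^ m) summable_on UNIV" and gy: "(\<lambda>m. y ^ m) summable_on UNIV"
    using assms by (auto intro!: norm_summable_imp_summable_on simp: norm_power)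
  have "(\<lambda>(m, n). x ^ m * y ^ n) summable_on UNIV \<times> UNIV"
    using assms gx gy
    by (intro summable_on_SigmaI[where g = "\<lambda>m. x ^ m * (\<Sum>\<^sub>\<infinity>n. y ^ n)"])
       (auto intro!: has_sum_cmult_right summable_on_cmult_left)
  then have "(\<lambda>p. C * (case p of (m, n) \<Rightarrow> x ^ m * y ^ n)) summable_on UNIV \<times> UNIV"
    by (rule summable_on_cmult_right)
  then have "(\<lambda>p. norm (case p of (m, n) \<Rightarrow> f m n)) summable_on UNIV \<times> UNIV"
    by (rule summable_on_comparison_test) (use bound in \<open>auto simp: mult.assoc\<close>)
  then have summ: "(\<lambda>(m, n). f m n) summable_on UNIV \<times> UNIV"
    by (rule abs_summable_summable)
  then have summ': "(\<lambda>(n, m). f m n) summable_on UNIV \<times> UNIV"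
    by (subst (asm) summable_on_swap) simp
  have iterated: "(\<lambda>m. \<Sum>n. g m n) sums (\<Sum>\<^sub>\<infinity>m. \<Sum>\<^sub>\<infinity>n. g m n)"
    if g: "(\<lambda>(m, n). g m n) summable_on UNIV \<times> UNIV" for g :: "nat \<Rightarrow> nat \<Rightarrow> complex"
  proof -
    have "(\<Sum>n. g m n) = (\<Sum>\<^sub>\<infinity>n. g m n)" for m
      using summable_on_SigmaD1[OF g, of m]
      by (metis UNIV_I has_sum_imp_sums has_sum_infsum sums_unique)
    moreover have "(\<lambda>m. \<Sum>\<^sub>\<infinity>n. g m n) summable_on UNIV"
      using summable_on_Sigma_banach[OF g] by simp
    ultimately show ?thesis
      by (simp add: has_sum_imp_sums has_sum_infsum)
  qed
  show ?thesis
    using that iterated[OF summ] iterated[OF summ'] infsum_swap_banach[OF summ] by simp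
qed

section \<open>The q-binomial series and Heine's transformation\<close>

text \<open>The difference equation \<open>(1 - z) F(z) = (1 - a z) F(q z)\<close> is iterated.\<close>
theorem q_binomial_series:
  assumes q: "norm q < 1" and z: "norm z < 1"
  shows "(\<lambda>n. qpoch a q n / qpoch q q n * z ^ n) sums (qpoch_inf (a * z) q / qpoch_inf z q)"
proof -
  define c where "c n = qpoch a q n / qpoch q q n" for n
  define F where "F w = (\<Sum>n. c n * w ^ n)" for w
  obtain M where M: "M > 0" "\<And>n. norm (c n) \<le> M"
    using qpoch_ratio_bounded[OF q, of a] unfolding c_def by blast
  have summ: "summable (\<lambda>n. c n * w ^ n)" if "norm w < 1" for w
  proof (rule summable_comparison_test'[where N = 0])
    show "summable (\<lambda>n. M * norm w ^ n)"
      using that by (intro summable_mult summable_geometric) simp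
    show "norm (c n * w ^ n) \<le> M * norm w ^ n" for n
      unfolding norm_mult norm_power using M by (intro mult_right_mono) auto
  qed
  \<comment> \<open>This recurrence of the coefficients is the difference equation read off at each
    power of \<open>w\<close>.\<close>
  have c_Suc: "c (Suc n) * (1 - q ^ Suc n) = c n * (1 - a * q ^ n)" for n
    using qpoch_nonzero[OF q q, of n] qpoch_nonzero[OF q q, of "Suc n"]
    by (simp add: c_def qpoch_Suc field_simps)
  have norm_qw: "norm (q * w) < 1" if "norm w < 1" for w
    using mult_strict_mono'[of "norm q" 1 "norm w" 1] q that by (simp add: norm_mult)
  have step: "(1 - w) * F w = (1 - a * w) * F (q * w)" if w: "norm w < 1" for w
  proof -
    let ?d = "\<lambda>n. c n * (1 - q ^ n) * w ^ n"
    have s1: "(\<lambda>n. c n * w ^ n) sums F w" and s2: "(\<lambda>n. c n * (q * w) ^ n) sums F (q * w)"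
      unfolding F_def using summ w norm_qw by (auto intro: summable_sums)
    have "?d sums (F w - F (q * w))"
      using sums_diff[OF s1 s2] by (simp add: algebra_simps power_mult_distrib)
    \<comment> \<open>The term at index 0 vanishes because of the factor \<open>1 - q ^ 0\<close>,
      so the shift costs nothing.\<close>
    then have "(\<lambda>n. ?d (Suc n)) sums (F w - F (q * w))"
      by (subst sums_Suc_iff) simp
    moreover have "?d (Suc n) = w * (c n * w ^ n) - a * w * (c n * (q * w) ^ n)" for n
      unfolding c_Suc by (simp add: algebra_simps power_mult_distrib)
    moreover have "(\<lambda>n. w * (c n * w ^ n) - a * w * (c n * (q * w) ^ n)) sums
        (w * F w - a * w * F (q * w))"
      by (intro sums_diff sums_mult s1 s2)
    ultimately have "F w - F (q * w) = w * F w - a * w * F (q * w)"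
      by (simp add: sums_iff)
    then show ?thesis by (simp add: algebra_simps)
  qed
  have norm_zq: "norm (z * q ^ N) < 1" for N
    by (induction N) (use z norm_qw in \<open>auto simp: mult.left_commute\<close>)
  have iter: "qpoch z q N * F z = qpoch (a * z) q N * F (z * q ^ N)" for N
  proof (induction N)
    case (Suc N)
    have "qpoch z q (Suc N) * F z = (1 - z * q ^ N) * (qpoch z q N * F z)"
      by (simp add: qpoch_Suc)
    also have "\<dots> = qpoch (a * z) q N * ((1 - z * q ^ N) * F (z * q ^ N))"
      by (simp only: Suc mult.left_commute)
    also have "\<dots> = qpoch (a * z) q (Suc N) * F (z * q ^ Suc N)"
      unfolding step[OF norm_zq] by (simp add: qpoch_Suc mult_ac)
    finally show ?case .
  qed simp
  \<comment> \<open>Continuity at 0 evaluates the limit of the iteration: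
    \<open>F (z * q ^ N)\<close> tends to \<open>F 0 = 1\<close>. The point \<open>1/2\<close> is
    just a nonzero point of convergence.\<close>
  have "isCont F 0"
    unfolding F_def by (rule isCont_powser[of _ "1/2"]) (auto intro: summ)
  moreover have "(\<lambda>N. z * q ^ N) \<longlonglongrightarrow> 0"
    using q by (intro tendsto_mult_right_zero LIMSEQ_power_zero) simp
  ultimately have "(\<lambda>N. F (z * q ^ N)) \<longlonglongrightarrow> F 0"
    by (rule isCont_tendsto_compose)
  moreover have "F 0 = 1"
    unfolding F_def powser_zero by (simp add: c_def)
  ultimately have "(\<lambda>N. qpoch z q N * F z) \<longlonglongrightarrow> qpoch_inf (a * z) q * 1"
    unfolding iter by (intro tendsto_mult qpoch_LIMSEQ q) simp
  moreover have "(\<lambda>N. qpoch z q N * F z) \<longlonglongrightarrow> qpoch_inf z q * F z"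
    by (intro tendsto_intros qpoch_LIMSEQ q)
  ultimately have "qpoch_inf z q * F z = qpoch_inf (a * z) q"
    using LIMSEQ_unique by fastforce
  then have "F z = qpoch_inf (a * z) q / qpoch_inf z q"
    using qpoch_inf_nonzero[OF q z] by (simp add: field_simps)
  then show ?thesis
    using summable_sums[OF summ[OF z]] by (simp add: F_def c_def)
qed


text \<open>Heine's transformation for \<open>c = a b\<close>, \<open>z = q\<close>: both \<open>(b;q)\<^sub>m / (a b;q)\<^sub>m\<close> and the
  resulting inner sums over \<open>m\<close> are evaluated by the q-binomial theorem.\<close>
lemma heine_ab_q:
  fixes a b q :: complex
  defines "t \<equiv> \<lambda>m. qpoch a q m * qpoch b q m / (qpoch q q m * qpoch (a * b) q m) * q ^ m"
  assumes q: "norm q < 1" and a: "norm a < 1" and b: "norm b < 1"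
  shows "summable t"
    and "(\<lambda>k. b ^ k / (1 - a * q ^ k)) sums
      (qpoch_inf (a * b) q * qpoch_inf q q / (qpoch_inf a q * qpoch_inf b q) * suminf t)"
proof -
  define c where "c n = qpoch a q n / qpoch q q n" for n
  \<comment> \<open>\<open>K\<close> is chosen so that \<open>K\<close> times the quotient of the
    infinite products at \<open>a * b * q ^ m\<close> and \<open>b * q ^ m\<close> is the quotient
    of the finite ones at \<open>b\<close> and \<open>a * b\<close>.\<close>
  define K where "K = qpoch_inf b q / qpoch_inf (a * b) q"
  obtain M where M: "M > 0" "\<And>n. norm (c n) \<le> M"
    using qpoch_ratio_bounded[OF q, of a] unfolding c_def by blast
  have ab: "norm (a * b) < 1"
    using mult_strict_mono'[of "norm a" 1 "norm b" 1] a b by (simp add: norm_mult)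
  have less_1: "norm (w * q ^ n) < 1" if "norm w < 1" for w n
  proof -
    have "norm (w * q ^ n) \<le> norm w * 1"
      unfolding norm_mult norm_power using q by (intro mult_left_mono power_le_one) auto
    then show ?thesis using that by simp
  qed
  \<comment> \<open>Summing this array over \<open>k\<close> rebuilds \<open>t m\<close>; summing
    over \<open>m\<close> gives a constant times \<open>b ^ k / (1 - a * q ^ k)\<close>.\<close>
  define f where "f m k = K * (c m * q ^ m) * (c k * (b * q ^ m) ^ k)" for m k
  have row: "(\<Sum>k. f m k) = t m" for m
  proof -
    have "(\<lambda>k. f m k) sums
        (K * (c m * q ^ m) * (qpoch_inf (a * (b * q ^ m)) q / qpoch_inf (b * q ^ m) q))"
      unfolding f_def c_def by (intro sums_mult q_binomial_series q less_1 b)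
    also have "K * (c m * q ^ m) * (qpoch_inf (a * (b * q ^ m)) q / qpoch_inf (b * q ^ m) q) = t m"
      using qpoch_nonzero[OF q ab, of m] qpoch_nonzero[OF q q, of m]
        qpoch_inf_nonzero[OF q less_1[OF ab, of m]] qpoch_inf_nonzero[OF q less_1[OF b, of m]]
      unfolding K_def c_def t_def qpoch_inf_split[OF q, of b m] qpoch_inf_split[OF q, of "a * b" m]
      by (simp add: divide_simps mult.assoc)
    finally show ?thesis by (simp add: sums_iff)
  qed
  have col: "(\<Sum>m. f m k) = K * (qpoch_inf a q / qpoch_inf q q) * (b ^ k / (1 - a * q ^ k))" for k
  proof -
    \<comment> \<open>The q-binomial series at \<open>z = q ^ (k + 1)\<close>. Its value times
      \<open>c k\<close> telescopes: the numerator lacks \<open>k + 1\<close> initial factors and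
      the denominator only \<open>k\<close>, which leaves
      \<open>1 / (1 - a * q ^ k)\<close>.\<close>
    have "(\<lambda>m. K * (c k * b ^ k) * (c m * (q * q ^ k) ^ m)) sums
        (K * (c k * b ^ k) * (qpoch_inf (a * (q * q ^ k)) q / qpoch_inf (q * q ^ k) q))"
      unfolding c_def by (intro sums_mult q_binomial_series q less_1)
    also have "(\<lambda>m. K * (c k * b ^ k) * (c m * (q * q ^ k) ^ m)) = (\<lambda>m. f m k)"
      by (rule ext) (simp add: f_def power_mult_distrib mult_ac flip: power_mult)
    also have "K * (c k * b ^ k) * (qpoch_inf (a * (q * q ^ k)) q / qpoch_inf (q * q ^ k) q) =
        K * (qpoch_inf a q / qpoch_inf q q) * (b ^ k / (1 - a * q ^ k))"
      using qpoch_nonzero[OF q q, of k] one_minus_mult_power_nonzero[OF q a, of k]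
        qpoch_inf_nonzero[OF q less_1[OF q, of k]]
      unfolding c_def qpoch_inf_split[OF q, of a "Suc k"] qpoch_inf_split[OF q, of q k] qpoch_Suc
      by (simp add: divide_simps)
    finally show ?thesis by (simp add: sums_iff)
  qed
  have "norm (f m k) \<le> (norm K * M * M) * norm q ^ m * norm b ^ k" for m k
  proof -
    have "norm (f m k) = norm K * (norm (c m) * norm q ^ m) * (norm (c k) * norm (b * q ^ m) ^ k)"
      by (simp add: f_def norm_mult norm_power)
    also have "\<dots> \<le> norm K * (M * norm q ^ m) * (M * norm b ^ k)"
    proof (intro mult_mono mult_left_mono power_mono M)
      show "norm (b * q ^ m) \<le> norm b"
        using q by (simp add: norm_mult norm_power mult_left_le power_le_one)
    qed (use M in auto)
    finally show ?thesis by (simp add: mult_ac)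
  qed
  then obtain S where S: "(\<lambda>m. \<Sum>k. f m k) sums S" "(\<lambda>k. \<Sum>m. f m k) sums S"
    by (rule sums_swap_geometric_bound) (use q b in auto)
  from S(1) have t: "t sums S"
    by (simp add: row)
  then show "summable t"
    by (rule sums_summable)
  \<comment> \<open>The factor common to all column sums; it is nonzero and can be divided
    out.\<close>
  define L where "L = K * (qpoch_inf a q / qpoch_inf q q)"
  have "L \<noteq> 0"
    using qpoch_inf_nonzero[OF q] q a b ab by (simp add: L_def K_def)
  from S(2) have "(\<lambda>k. L * (b ^ k / (1 - a * q ^ k))) sums S"
    by (simp add: col L_def)
  from sums_mult[OF this, of "inverse L"]
  have "(\<lambda>k. b ^ k / (1 - a * q ^ k)) sums (inverse L * S)"
    using \<open>L \<noteq> 0\<close> by (simp add: field_simps)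
  also have "inverse L = qpoch_inf (a * b) q * qpoch_inf q q / (qpoch_inf a q * qpoch_inf b q)"
    by (simp add: L_def K_def field_simps)
  also have "S = suminf t"
    using t by (simp add: sums_iff)
  finally show "(\<lambda>k. b ^ k / (1 - a * q ^ k)) sums
      (qpoch_inf (a * b) q * qpoch_inf q q / (qpoch_inf a q * qpoch_inf b q) * suminf t)" .
qed

text \<open>Heine's transformation with \<open>a = - \<i> * h * q ^ j\<close> and
  \<open>b = \<i> * h * q ^ j\<close>, so that \<open>a * b = q ^ (2 * j + 1)\<close>. The series
  over \<open>m\<close> is what remains of the sum over \<open>n = m + j\<close> once the two sums
  of the main identity are interchanged.\<close>

lemma lambert_series_sums:
  fixes h :: complex and j :: nat
  defines "q \<equiv> h ^ 2"
  assumes "h \<noteq> 0" and h: "norm h < 1"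
  shows "(\<lambda>n. (\<i> * h * q ^ j) ^ n / (1 + \<i> * h * q ^ j * q ^ n)) sums
    (qpoch_inf q q ^ 2 / (qpoch_inf (- q) (q ^ 2) * q ^ j) *
      (\<Sum>m. qpoch (- q) (q ^ 2) (m + j) * q ^ (m + j) / (qpoch q q m * qpoch q q (m + 2 * j))))"
proof -
  have q: "norm q < 1" and "q \<noteq> 0"
    using assms by (auto simp: norm_power power_less_one_iff)
  define a b where "a = - \<i> * h * q ^ j" and "b = \<i> * h * q ^ j"
  have "norm (h * q ^ j) \<le> norm h * 1"
    unfolding norm_mult norm_power using q by (intro mult_left_mono power_le_one) auto
  then have a: "norm a < 1" and b: "norm b < 1"
    using h by (simp_all add: a_def b_def norm_mult)
  have ih: "norm (\<i> * h) < 1" "norm (- \<i> * h) < 1"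
    using h by (simp_all add: norm_mult)
  have "a * b = h ^ 2 * (q ^ j * q ^ j)"
    by (simp add: a_def b_def power2_eq_square mult_ac)
  then have ab: "a * b = q * q ^ (2 * j)"
    by (simp add: q_def mult_2 power_add)
  define t where "t m = qpoch a q m * qpoch b q m / (qpoch q q m * qpoch (a * b) q m) * q ^ m" for m
  \<comment> \<open>The part of the summand independent of \<open>m\<close>: the initial factors
    split off when each symbol is shifted to start at \<open>a\<close>, \<open>b\<close> or
    \<open>a * b\<close>.\<close>
  define c where "c = q ^ j * (qpoch (- \<i> * h) q j * qpoch (\<i> * h) q j) / qpoch q q (2 * j)"
  note heine = heine_ab_q[OF q a b, folded t_def]
  have "qpoch (- q) (q ^ 2) (m + j) * q ^ (m + j) / (qpoch q q m * qpoch q q (m + 2 * j)) = c * t m"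
    for m
    using qpoch_add[of "\<i> * h" q j m] qpoch_add[of "- \<i> * h" q j m] qpoch_add[of q q "2 * j" m]
      qpoch_neg_square[of h q "m + j"]
    unfolding t_def ab by (simp add: c_def a_def b_def power_add add.commute q_def mult_ac)
  then have G: "(\<Sum>m. qpoch (- q) (q ^ 2) (m + j) * q ^ (m + j) /
      (qpoch q q m * qpoch q q (m + 2 * j))) = c * suminf t"
    using heine(1) by (simp add: suminf_mult)
  have D: "qpoch_inf (- q) (q ^ 2) =
      (qpoch (- \<i> * h) q j * qpoch (\<i> * h) q j) * (qpoch_inf a q * qpoch_inf b q)"
    using qpoch_inf_neg_square[OF q, of h] qpoch_inf_split[OF q, of "\<i> * h" j]
      qpoch_inf_split[OF q, of "- \<i> * h" j]
    by (simp add: a_def b_def q_def)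
  have "qpoch_inf (a * b) q * qpoch_inf q q / (qpoch_inf a q * qpoch_inf b q) * suminf t =
     qpoch_inf q q ^ 2 / (qpoch_inf (- q) (q ^ 2) * q ^ j) * (c * suminf t)"
    using qpoch_nonzero[OF q ih(1), of j] qpoch_nonzero[OF q ih(2), of j] \<open>q \<noteq> 0\<close>
      qpoch_inf_nonzero[OF q a] qpoch_inf_nonzero[OF q b] qpoch_nonzero[OF q q, of "2 * j"]
    unfolding D c_def ab qpoch_inf_split[OF q, of q "2 * j"]
    by (simp add: power2_eq_square divide_simps)
  with heine(2) G show ?thesis
    by (simp add: a_def b_def)
qed

section \<open>The finite q-binomial theorem and the finite Jacobi triple product\<close>

lemma Suc_choose_two: "Suc k choose 2 = (k choose 2) + k"
  by (simp add: numeral_2_eq_2)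

text \<open>Induction on \<open>N\<close>, with Gaussian binomial coefficients and their q-Pascal
  rule. Dividing by \<open>qpoch q q N\<close> leaves only reciprocal symbols on the right.\<close>

theorem q_binomial_finite:
  assumes q: "norm q < 1"
  shows "qpoch x q N / qpoch q q N =
    (\<Sum>k\<le>N. (-1) ^ k * q ^ (k choose 2) * x ^ k / (qpoch q q k * qpoch q q (N - k)))"
proof -
  \<comment> \<open>The Gaussian binomial coefficient. The value 0 for \<open>k > N\<close> makes
    the Pascal rule hold at \<open>k = N\<close> and kills the extra top term in the
    induction.\<close>
  define B where "B N k = (if k \<le> N then qpoch q q N / (qpoch q q k * qpoch q q (N - k)) else 0)"
    for N k
  define c where "c N k = (-1) ^ k * q ^ (k choose 2) * B N k" for N k
  note nz = qpoch_nonzero[OF q q]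
  have pascal: "B (Suc N) (Suc k) = B N (Suc k) + q ^ (N - k) * B N k" if "k \<le> N" for N k
  proof (cases "k = N")
    case True
    then show ?thesis using nz by (simp add: B_def)
  next
    case False
    then obtain d where N: "N = Suc (k + d)"
      using \<open>k \<le> N\<close> by (metis add_Suc_right le_Suc_ex le_neq_implies_less less_imp_Suc_add)
    have nk: "1 - q * q ^ k \<noteq> 0" "1 - q * q ^ d \<noteq> 0"
      using nz[of "Suc k"] nz[of "Suc d"] by (auto simp: qpoch_Suc)
    show ?thesis
      using nz[of k] nz[of d] nk unfolding N B_def
      by (simp add: Suc_diff_le qpoch_Suc divide_simps) (simp add: algebra_simps power_add)
  qed
  have c_Suc: "c (Suc N) (Suc k) = c N (Suc k) - q ^ N * c N k" if "k \<le> N" for N k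
  proof -
    have "q ^ N = q ^ k * q ^ (N - k)"
      using that by (simp flip: power_add)
    then show ?thesis
      by (simp add: c_def pascal[OF that] Suc_choose_two power_add algebra_simps)
  qed
  have c_0: "c N 0 = 1" for N
    using nz[of N] by (simp add: c_def B_def numeral_2_eq_2)
  have "qpoch x q N = (\<Sum>k\<le>N. c N k * x ^ k)"
  proof (induction N)
    case 0
    then show ?case by (simp add: c_0)
  next
    case (Suc N)
    have "(\<Sum>k\<le>Suc N. c (Suc N) k * x ^ k) = 1 + (\<Sum>k\<le>N. c (Suc N) (Suc k) * x ^ Suc k)"
      by (simp add: sum.atMost_Suc_shift c_0 del: sum.atMost_Suc)
    also have "(\<Sum>k\<le>N. c (Suc N) (Suc k) * x ^ Suc k) =
        (\<Sum>k\<le>N. c N (Suc k) * x ^ Suc k) - x * q ^ N * (\<Sum>k\<le>N. c N k * x ^ k)"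
      by (simp add: c_Suc sum_distrib_left flip: sum_subtractf) (simp add: algebra_simps)
    also have "1 + \<dots> = (\<Sum>k\<le>Suc N. c N k * x ^ k) - x * q ^ N * (\<Sum>k\<le>N. c N k * x ^ k)"
      by (simp add: sum.atMost_Suc_shift c_0 del: sum.atMost_Suc)
    also have "(\<Sum>k\<le>Suc N. c N k * x ^ k) = (\<Sum>k\<le>N. c N k * x ^ k)"
      by (simp add: c_def B_def)
    finally show ?case
      by (simp add: Suc.IH qpoch_Suc algebra_simps)
  qed
  then show ?thesis
    using nz[of N] by (simp add: sum_divide_distrib c_def B_def mult_ac)
qed

text \<open>For \<open>k = 1..n\<close> the factors satisfy
  \<open>1 - z / q ^ k = - (z / q ^ k) * (1 - q ^ k / z)\<close>; the exponents \<open>k\<close> add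
  up to \<open>Suc n choose 2\<close>.\<close>

lemma qpoch_reverse:
  assumes "z \<noteq> 0" "q \<noteq> 0"
  shows "qpoch (z / q ^ n) q n * q ^ (Suc n choose 2) = (- z) ^ n * qpoch (q / z) q n"
proof (induction n)
  case (Suc n)
  have "qpoch (z / q ^ Suc n) q (Suc n) = (1 - z / q ^ Suc n) * qpoch (z / q ^ n) q n"
    using qpoch_add[of "z / q ^ Suc n" q 1 n] assms by (simp add: qpoch_def)
  then have "qpoch (z / q ^ Suc n) q (Suc n) * q ^ (Suc (Suc n) choose 2) =
      (1 - z / q ^ Suc n) * q ^ Suc n * (qpoch (z / q ^ n) q n * q ^ (Suc n choose 2))"
    by (simp add: Suc_choose_two[of "Suc n"] power_add)
  also have "(1 - z / q ^ Suc n) * q ^ Suc n = - z * (1 - q / z * q ^ n)"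
    using assms by (simp add: field_simps)
  finally show ?case
    unfolding Suc.IH by (simp add: qpoch_Suc)
qed (simp add: numeral_2_eq_2)

lemma sum_atMost_double_centred:
  fixes f :: "nat \<Rightarrow> 'a :: comm_monoid_add"
  shows "(\<Sum>k\<le>2 * n. f k) = f n + (\<Sum>j=1..n. f (n + j) + f (n - j))"
proof -
  have "{..2 * n} = {n} \<union> ({n<..2 * n} \<union> {..<n})"
    by auto
  then have "(\<Sum>k\<le>2 * n. f k) = f n + (sum f {n<..2 * n} + sum f {..<n})"
    by (simp add: sum.union_disjoint[of "{n<..2 * n}" "{..<n}"] disjoint_iff)
  also have "sum f {n<..2 * n} = (\<Sum>j=1..n. f (n + j))"
    by (rule sum.reindex_bij_witness[of _ "\<lambda>j. n + j" "\<lambda>k. k - n"]) auto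
  also have "sum f {..<n} = (\<Sum>j=1..n. f (n - j))"
    by (rule sum.reindex_bij_witness[of _ "\<lambda>j. n - j" "\<lambda>k. n - k"]) auto
  finally show ?thesis by (simp add: sum.distrib)
qed

text \<open>A division-free form, which reduces the exponent identities below to polynomial
  arithmetic.\<close>

lemma choose_two_double: "2 * (k choose 2) + k = k ^ 2"
  by (induction k) (simp_all add: Suc_choose_two power2_eq_square numeral_2_eq_2)

text \<open>Take \<open>N = 2 * n\<close> and \<open>x = z / q ^ n\<close> in the finite q-binomial
  theorem. The first half of the product is reversed into the symbol of \<open>q / z\<close>, and
  the sum is folded about its central index \<open>n\<close>.\<close>

theorem jacobi_triple_product_finite:
  assumes q: "norm q < 1" and "q \<noteq> 0" and "z \<noteq> 0"
  shows "qpoch z q n * qpoch (q / z) q n / qpoch q q (2 * n) = 1 / qpoch q q n ^ 2 +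
    (\<Sum>j=1..n. (-1) ^ j * q ^ (j choose 2) * (z ^ j + (q / z) ^ j) /
      (qpoch q q (n - j) * qpoch q q (n + j)))"
proof -
  \<comment> \<open>The factor produced by the reversal; every term of the sum contains it as well,
    and it cancels at the end.\<close>
  define P where "P = (- z) ^ n / q ^ (Suc n choose 2)"
  have "P \<noteq> 0" using assms by (simp add: P_def)
  define f where "f k = (-1) ^ k * q ^ (k choose 2) * (z / q ^ n) ^ k /
    (qpoch q q k * qpoch q q (2 * n - k))" for k
  have "qpoch (z / q ^ n) q (2 * n) = P * (qpoch z q n * qpoch (q / z) q n)"
    using qpoch_add[of "z / q ^ n" q n n] qpoch_reverse[of z q n] assms
    unfolding mult_2 by (simp add: P_def field_simps)
  then have "P * (qpoch z q n * qpoch (q / z) q n) / qpoch q q (2 * n) = (\<Sum>k\<le>2 * n. f k)"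
    using q_binomial_finite[OF q, of "z / q ^ n" "2 * n"] by (simp add: f_def)
  also have "\<dots> = f n + (\<Sum>j=1..n. f (n + j) + f (n - j))"
    by (rule sum_atMost_double_centred)
  also have "f (n + j) = P * ((-1) ^ j * q ^ (j choose 2) * z ^ j /
      (qpoch q q (n - j) * qpoch q q (n + j)))" for j
  proof -
    have "(n + j choose 2) + (Suc n choose 2) = n * (n + j) + (j choose 2)"
      using choose_two_double[of "n + j"] choose_two_double[of n] choose_two_double[of j]
      by (simp add: Suc_choose_two power2_eq_square algebra_simps)
    then have "q ^ (n + j choose 2) * q ^ (Suc n choose 2) = q ^ (n * (n + j)) * q ^ (j choose 2)"
      by (metis power_add)
    then have "q ^ (n + j choose 2) / q ^ (n * (n + j)) = q ^ (j choose 2) / q ^ (Suc n choose 2)"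
      using assms by (simp add: field_simps)
    moreover have "f (n + j) = (-1) ^ (n + j) * z ^ (n + j) *
        (q ^ (n + j choose 2) / q ^ (n * (n + j))) / (qpoch q q (n - j) * qpoch q q (n + j))"
      by (simp add: f_def power_divide mult_2 mult_ac flip: power_mult)
    ultimately show ?thesis
      by (simp add: P_def power_add power_minus[of z] mult_ac)
  qed
  moreover have "f (n - j) = P * ((-1) ^ j * q ^ (j choose 2) * (q / z) ^ j /
      (qpoch q q (n - j) * qpoch q q (n + j)))" if j: "j \<in> {1..n}" for j
  proof -
    obtain d where n: "n = j + d"
      using j le_Suc_ex[of j n] by auto
    then have idx: "2 * n - d = n + j" "n - j = d"
      by simp_all
    have "(d choose 2) + (Suc n choose 2) = n * d + ((j choose 2) + j)"
      using choose_two_double[of d] choose_two_double[of n] choose_two_double[of j]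
      by (simp add: n Suc_choose_two power2_eq_square algebra_simps)
    then have "q ^ (d choose 2) * q ^ (Suc n choose 2) = q ^ (n * d) * (q ^ (j choose 2) * q ^ j)"
      by (metis power_add)
    then have "q ^ (d choose 2) / q ^ (n * d) = q ^ (j choose 2) * q ^ j / q ^ (Suc n choose 2)"
      using assms by (simp add: field_simps)
    moreover have "f d = (-1) ^ d * z ^ d * (q ^ (d choose 2) / q ^ (n * d)) /
        (qpoch q q (n - j) * qpoch q q (n + j))"
      unfolding f_def idx by (simp add: power_divide mult_ac flip: power_mult)
    moreover have "z ^ d = z ^ n / z ^ j" "(-1 :: complex) ^ d = (-1) ^ n * (-1) ^ j"
      using \<open>z \<noteq> 0\<close> by (simp_all add: n power_add)
    ultimately show ?thesis
      by (simp add: P_def idx power_divide power_minus[of z] mult_ac)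
  qed
  \<comment> \<open>The central term is the case \<open>j = 0\<close> of the formula for
    \<open>f (n + j)\<close>, which is \<open>calculation(2)\<close>.\<close>
  moreover have "f n = P * (1 / qpoch q q n ^ 2)"
    using calculation(2)[of 0] by (simp add: numeral_2_eq_2)
  ultimately have "P * (qpoch z q n * qpoch (q / z) q n / qpoch q q (2 * n)) =
    P * (1 / qpoch q q n ^ 2 + (\<Sum>j=1..n. (-1) ^ j * q ^ (j choose 2) * (z ^ j + (q / z) ^ j) /
      (qpoch q q (n - j) * qpoch q q (n + j))))"
    by (simp add: distrib_left sum_distrib_left add_divide_distrib)
  then show ?thesis unfolding mult_cancel_left using \<open>P \<noteq> 0\<close> by blast
qed

text \<open>Subtracting the instance \<open>z = 1\<close>, whose left-hand side vanishes, removes the constant term.\<close>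
lemma qpoch_product_expansion:
  assumes q: "norm q < 1" and "q \<noteq> 0" and "z \<noteq> 0" and "n > 0"
  shows "qpoch z q n * qpoch (q / z) q n / qpoch q q (2 * n) =
    (\<Sum>j=1..n. (-1) ^ (j + 1) * q ^ (j choose 2) * (1 - z ^ j) * (1 - (q / z) ^ j) /
      (qpoch q q (n - j) * qpoch q q (n + j)))"
proof -
  have "qpoch 1 q n = 0"
    using \<open>n > 0\<close> by (auto simp: qpoch_def intro!: bexI[of _ 0])
  then have "qpoch z q n * qpoch (q / z) q n / qpoch q q (2 * n) =
      qpoch z q n * qpoch (q / z) q n / qpoch q q (2 * n) -
      qpoch 1 q n * qpoch (q / 1) q n / qpoch q q (2 * n)"
    by simp
  also have "\<dots> = (\<Sum>j=1..n. (-1) ^ j * q ^ (j choose 2) * (z ^ j + (q / z) ^ j) /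
        (qpoch q q (n - j) * qpoch q q (n + j)) -
      (-1) ^ j * q ^ (j choose 2) * (1 ^ j + (q / 1) ^ j) /
        (qpoch q q (n - j) * qpoch q q (n + j)))"
    using assms jacobi_triple_product_finite[of q z n] jacobi_triple_product_finite[of q 1 n]
    by (simp add: sum_subtractf)
  also have "\<dots> = (\<Sum>j=1..n. (-1) ^ (j + 1) * q ^ (j choose 2) * (1 - z ^ j) * (1 - (q / z) ^ j) /
      (qpoch q q (n - j) * qpoch q q (n + j)))"
  proof (rule sum.cong)
    \<comment> \<open>The product of \<open>z ^ j\<close> and \<open>(q / z) ^ j\<close> does not
      depend on \<open>z\<close>; hence the difference of the two instances factors.\<close>
    fix j
    have "z ^ j * (q / z) ^ j = q ^ j"
      using \<open>z \<noteq> 0\<close> by (simp add: power_divide)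
    then have "z ^ j + (q / z) ^ j - (1 + q ^ j) = - ((1 - z ^ j) * (1 - (q / z) ^ j))"
      by (simp add: algebra_simps)
    then show "(-1) ^ j * q ^ (j choose 2) * (z ^ j + (q / z) ^ j) /
        (qpoch q q (n - j) * qpoch q q (n + j)) -
      (-1) ^ j * q ^ (j choose 2) * (1 ^ j + (q / 1) ^ j) /
        (qpoch q q (n - j) * qpoch q q (n + j)) =
      (-1) ^ (j + 1) * q ^ (j choose 2) * (1 - z ^ j) * (1 - (q / z) ^ j) /
      (qpoch q q (n - j) * qpoch q q (n + j))"
      by (simp add: mult.assoc flip: diff_divide_distrib right_diff_distrib)
  qed simp
  finally show ?thesis .
qed

section \<open>Assembly of the identity\<close>

text \<open>The variable \<open>\<tau>\<close> fixes the branch \<open>qh\<close> of the square root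
  of \<open>q\<close>, so the half-integral powers become \<open>qh ^ n\<close> and
  \<open>q ^ (j + n) * qh\<close>. The index \<open>m\<close> stands for
  \<open>j - 1\<close>.\<close>

theorem theorem3p1:
  fixes \<tau> \<zeta> :: complex
  defines "q \<equiv> exp (2 * pi * \<i> * \<tau>)"
  defines "qh \<equiv> exp (pi * \<i> * \<tau>)"
  assumes "Im \<tau> > 0"
  assumes "norm q < norm \<zeta>" and "norm \<zeta> < 1"
  shows "Pbar_omega \<zeta> q =
    1 / (qpoch_inf \<zeta> q * qpoch_inf (q / \<zeta>) q * qpoch_inf q q) *
    (\<Sum>m. \<Sum>n. (let j = Suc m in
       (-1) ^ (j + 1) * \<i> ^ n * (1 - \<zeta> ^ j) * (1 - (q / \<zeta>) ^ j) *
       (q ^ (j * (j + 1) div 2 + n * j) * qh ^ n)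
       / (1 + \<i> * q ^ (j + n) * qh)))"
proof -
  have "qh \<noteq> 0" "q \<noteq> 0" and q_qh: "q = qh ^ 2"
    by (simp_all add: q_def qh_def mult_ac flip: exp_double)
  have qh: "norm qh < 1"
    using \<open>Im \<tau> > 0\<close> by (simp add: qh_def norm_exp_eq_Re)
  have q: "norm q < 1" and "\<zeta> \<noteq> 0" and quot: "norm (q / \<zeta>) < 1"
    using assms(4,5) by (auto simp: norm_divide divide_simps)
  have nq2: "norm (- q) < 1" "norm (q ^ 2) < 1"
    using q by (simp_all add: norm_power power_less_one_iff)
  let ?D = "qpoch_inf (- q) (q ^ 2)"
  have nz: "?D \<noteq> 0" "qpoch_inf q q \<noteq> 0"
    using qpoch_inf_nonzero q nq2 by auto
  define w where "w j = (-1) ^ (j + 1) * q ^ (j choose 2) * (1 - \<zeta> ^ j) * (1 - (q / \<zeta>) ^ j)" for j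
  define g where "g n j = qpoch (- q) (q ^ 2) n * q ^ n / (qpoch q q (n - j) * qpoch q q (n + j))"
    for n j
  \<comment> \<open>The triangle \<open>1 \<le> j \<le> n\<close> with \<open>n = Suc m\<close> and
    \<open>j = Suc i\<close>, extended by zero to a full array.\<close>
  define f where "f m i = (if i \<le> m then w (Suc i) * g (Suc m) (Suc i) else 0)" for m i

  have row: "(\<Sum>i. f m i) = qpoch \<zeta> q (Suc m) * qpoch (q / \<zeta>) q (Suc m) *
      qpoch (- q) (q ^ 2) (Suc m) / qpoch q q (2 * Suc m) * q ^ Suc m" for m
  proof -
    have "(\<Sum>i. f m i) = (\<Sum>i\<le>m. f m i)"
      by (rule suminf_finite) (auto simp: f_def)
    also have "\<dots> = (\<Sum>j=1..Suc m. w j * g (Suc m) j)"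
      by (rule sum.reindex_bij_witness[of _ "\<lambda>j. j - 1" Suc]) (auto simp: f_def)
    also have "\<dots> = qpoch (- q) (q ^ 2) (Suc m) * q ^ Suc m *
        (qpoch \<zeta> q (Suc m) * qpoch (q / \<zeta>) q (Suc m) / qpoch q q (2 * Suc m))"
      unfolding qpoch_product_expansion[OF q \<open>q \<noteq> 0\<close> \<open>\<zeta> \<noteq> 0\<close> zero_less_Suc] sum_distrib_left
      by (intro sum.cong) (simp_all add: w_def g_def mult_ac)
    finally show ?thesis by (simp add: mult_ac)
  qed

  obtain A where A: "A > 0" "\<And>n. norm (qpoch (- q) (q ^ 2) n) \<le> A"
    using qpoch_bounded[OF nq2(2)] by blast
  obtain B where B: "B > 0" "\<And>n. norm (inverse (qpoch q q n)) \<le> B"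
    using inverse_qpoch_bounded[OF q q] by blast
  \<comment> \<open>Valid also for \<open>j > n\<close>, where \<open>n - j\<close> is 0;
    summability of \<open>g n (Suc i)\<close> over all \<open>n\<close> is derived from it.\<close>
  have g_bound: "norm (g n j) \<le> A * B * B * norm q ^ n" for n j
  proof -
    have "norm (g n j) = norm (qpoch (- q) (q ^ 2) n) * norm (inverse (qpoch q q (n - j))) *
        norm (inverse (qpoch q q (n + j))) * norm q ^ n"
      by (simp add: g_def norm_mult norm_divide norm_power norm_inverse divide_inverse mult_ac)
    also have "\<dots> \<le> A * B * B * norm q ^ n"
      using A(1) B(1) by (intro mult_right_mono mult_mono A B) auto
    finally show ?thesis .
  qed
  \<comment> \<open>The decay in \<open>i\<close> comes from
    \<open>i \<le> (Suc i choose 2)\<close>; each of the two differences has norm at most 2.\<close>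
  have w_bound: "norm (w (Suc i)) \<le> 4 * norm q ^ i" for i
  proof -
    have two: "norm (1 - x ^ k) \<le> 2" if "norm x < 1" for x :: complex and k
      using norm_triangle_ineq4[of 1 "x ^ k"] power_le_one[of "norm x" k] that
      by (simp add: norm_power)
    have "norm (w (Suc i)) =
        norm q ^ (Suc i choose 2) * (norm (1 - \<zeta> ^ Suc i) * norm (1 - (q / \<zeta>) ^ Suc i))"
      by (simp add: w_def norm_mult norm_power)
    also have "\<dots> \<le> norm q ^ i * (2 * 2)"
      using q by (intro mult_mono two quot \<open>norm \<zeta> < 1\<close> power_decreasing) (auto simp: Suc_choose_two)
    finally show ?thesis by simp
  qed
  have f_bound: "norm (f m i) \<le> 4 * (A * B * B * norm q) * norm q ^ m * norm q ^ i" for m i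
  proof (cases "i \<le> m")
    case True
    then have "norm (f m i) = norm (w (Suc i)) * norm (g (Suc m) (Suc i))"
      by (simp add: f_def norm_mult)
    also have "\<dots> \<le> (4 * norm q ^ i) * (A * B * B * norm q ^ Suc m)"
      by (intro mult_mono w_bound g_bound) auto
    finally show ?thesis by (simp add: mult_ac)
  qed (use A B in \<open>simp add: f_def\<close>)
  obtain S where S: "(\<lambda>m. \<Sum>i. f m i) sums S" "(\<lambda>i. \<Sum>m. f m i) sums S"
    by (rule sums_swap_geometric_bound[OF f_bound]) (use q in auto)

  have col: "(\<Sum>m. f m i) = w (Suc i) * (\<Sum>m. g (m + Suc i) (Suc i))" for i
  proof -
    have geom: "summable (\<lambda>m. C * norm q ^ m)" for C
      using q by (intro summable_mult summable_geometric) simp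
    have "summable (\<lambda>n. g n (Suc i))"
      by (rule summable_comparison_test'[OF geom g_bound])
    then have "summable (\<lambda>m. g (m + Suc i) (Suc i))"
      by (rule summable_ignore_initial_segment)
    moreover have "summable (\<lambda>m. f m i)"
      by (rule summable_comparison_test'[OF geom[of "4 * (A * B * B * norm q) * norm q ^ i"], of 0])
         (use f_bound[of _ i] in \<open>simp add: mult_ac\<close>)
    \<comment> \<open>The first \<open>i\<close> entries of the column are zero, so it may start at
      \<open>m = i\<close>, that is, at \<open>n = j\<close>.\<close>
    then have "(\<Sum>m. f m i) = (\<Sum>m. f (m + i) i) + (\<Sum>m<i. f m i)"
      by (rule suminf_split_initial_segment)
    then have "(\<Sum>m. f m i) = (\<Sum>m. w (Suc i) * g (m + Suc i) (Suc i))"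
      by (simp add: f_def)
    ultimately show ?thesis
      by (simp only: suminf_mult)
  qed

  have "(\<Sum>n. (let j = Suc i in
       (-1) ^ (j + 1) * \<i> ^ n * (1 - \<zeta> ^ j) * (1 - (q / \<zeta>) ^ j) *
       (q ^ (j * (j + 1) div 2 + n * j) * qh ^ n) / (1 + \<i> * q ^ (j + n) * qh))) =
     qpoch_inf q q ^ 2 / ?D * (\<Sum>m. f m i)" for i
  proof -
    define j where "j = Suc i"
    \<comment> \<open>Splitting off \<open>q ^ j\<close> from the exponent matches the
      \<open>q ^ j\<close> in the denominator of \<open>lambert_series_sums\<close>; the two
      cancel.\<close>
    have "j * (j + 1) div 2 = (j choose 2) + j"
      using choose_two[of "Suc j"] by (simp add: Suc_choose_two mult.commute)
    then have "(-1) ^ (j + 1) * \<i> ^ n * (1 - \<zeta> ^ j) * (1 - (q / \<zeta>) ^ j) *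
        (q ^ (j * (j + 1) div 2 + n * j) * qh ^ n) / (1 + \<i> * q ^ (j + n) * qh) =
        w j * q ^ j * ((\<i> * qh * q ^ j) ^ n / (1 + \<i> * qh * q ^ j * q ^ n))" for n
      by (simp add: w_def power_add power_mult_distrib mult_ac flip: power_mult)
    moreover have "(\<lambda>n. w j * q ^ j * ((\<i> * qh * q ^ j) ^ n / (1 + \<i> * qh * q ^ j * q ^ n))) sums
        (w j * q ^ j * (qpoch_inf q q ^ 2 / (?D * q ^ j) * (\<Sum>m. g (m + j) j)))"
      using lambert_series_sums[OF \<open>qh \<noteq> 0\<close> qh, of j, folded q_qh]
      by (intro sums_mult) (simp add: g_def add.assoc mult_2)
    ultimately show ?thesis
      using \<open>q \<noteq> 0\<close> by (simp add: col j_def sums_iff Let_def)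
  qed
  then have "(\<Sum>m. \<Sum>n. (let j = Suc m in
       (-1) ^ (j + 1) * \<i> ^ n * (1 - \<zeta> ^ j) * (1 - (q / \<zeta>) ^ j) *
       (q ^ (j * (j + 1) div 2 + n * j) * qh ^ n) / (1 + \<i> * q ^ (j + n) * qh))) =
     qpoch_inf q q ^ 2 / ?D * S"
    using sums_mult[OF S(2), of "qpoch_inf q q ^ 2 / ?D"] by (simp add: sums_iff)
  moreover have "Pbar_omega \<zeta> q =
      qpoch_inf q q / (qpoch_inf \<zeta> q * qpoch_inf (q / \<zeta>) q * ?D) * S"
    using S(1) by (simp add: Pbar_omega_def Let_def row sums_iff)
  ultimately show ?thesis
    using nz by (simp add: power2_eq_square)
qed

end
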